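(* Let $G$ be the $5$-cycle with nodes $1,\dots,5$ and edges $12,13,24,35,45$. For $\lambda\in\mathrm{Ncond}(G)$ put $$a(\lambda)=\frac{\lambda_3(\lambda_1+\lambda_4)}{\lambda_1+\lambda_4-\lambda_2}+\frac{\lambda_4(\lambda_2+\lambda_3)}{\lambda_2+\lambda_3-\lambda_1},\qquad \tilde\alpha(\lambda)=\left[1+\frac{\lambda_1}{\lambda_2+\lambda_3-\lambda_1}+\frac{\lambda_2}{\lambda_1+\lambda_4-\lambda_2}\right]^{-1}.$$ Then the following inclusion is strict: $$\{\lambda:\ \lambda_5<a(\lambda)\tilde\alpha(\lambda)\}\cap\mathrm{Ncond}(G)\subsetneq\mathrm{Ncond}(G).$$
   Context: $\mathrm{Ncond}(G)$ is the set of $\lambda\in(0,\infty)^{5}$ such that $\sum_{i\in\mathcal I}\lambda_i<\sum_{j\in\mathcal E(\mathcal I)}\lambda_j$ for every non-empty independent set $\mathcal I$ of $G$, where $\mathcal E(\mathcal I)$ is the set of nodes adjacent to some node of $\mathcal I$. In particular $\lambda\in\mathrm{Ncond}(G)$ implies $\lambda_1<\lambda_2+\lambda_3$ and $\lambda_2<\lambda_1+\lambda_4$, so $a$ and $\tilde\alpha$ are well defined. *)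

theory Defs
  imports Complex_Main "HOL-Library.FuncSet"
begin

(* A finite simple graph is given by its node set V and its set E of
   two-element edges {i, j}. *)

definition independent_set :: "'v set \<Rightarrow> 'v set set \<Rightarrow> 'v set \<Rightarrow> bool" where
  "independent_set V E I \<longleftrightarrow> I \<subseteq> V \<and> (\<forall>i\<in>I. \<forall>j\<in>I. {i, j} \<notin> E)"

definition nbhd :: "'v set \<Rightarrow> 'v set set \<Rightarrow> 'v set \<Rightarrow> 'v set" where
  "nbhd V E I = {j \<in> V. \<exists>i\<in>I. {i, j} \<in> E}"

(* The product of copies of (0, infinity) indexed by V is the extensional
   function space PiE, so that a rate vector is determined by its values on V. *)
definition Ncond :: "'v set \<Rightarrow> 'v set set \<Rightarrow> ('v \<Rightarrow> real) set" where
  "Ncond V E = {l \<in> V \<rightarrow>\<^sub>E {0<..}.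
     \<forall>I. I \<noteq> {} \<and> independent_set V E I \<longrightarrow> (\<Sum>i\<in>I. l i) < (\<Sum>j\<in>nbhd V E I. l j)}"

definition C5_nodes :: "nat set" where
  "C5_nodes = {1, 2, 3, 4, 5}"

definition C5_edges :: "nat set set" where
  "C5_edges = {{1, 2}, {1, 3}, {2, 4}, {3, 5}, {4, 5}}"

definition a_fun :: "(nat \<Rightarrow> real) \<Rightarrow> real" where
  "a_fun l = l 3 * (l 1 + l 4) / (l 1 + l 4 - l 2) + l 4 * (l 2 + l 3) / (l 2 + l 3 - l 1)"

definition alpha_tilde :: "(nat \<Rightarrow> real) \<Rightarrow> real" where
  "alpha_tilde l = inverse (1 + l 1 / (l 2 + l 3 - l 1) + l 2 / (l 1 + l 4 - l 2))"

(* All denominators in a_fun and alpha_tilde are positive on Ncond of the 5-cycle. *)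
lemma Ncond_C5_denominators:
  assumes "l \<in> Ncond C5_nodes C5_edges"
  shows "l 1 < l 2 + l 3" and "l 2 < l 1 + l 4"
    and "0 < 1 + l 1 / (l 2 + l 3 - l 1) + l 2 / (l 1 + l 4 - l 2)"
proof -
  have sum_less: "sum l I < sum l (nbhd C5_nodes C5_edges I)"
    if "I \<noteq> {}" "independent_set C5_nodes C5_edges I" for I
    using assms that by (auto simp: Ncond_def)
  have "independent_set C5_nodes C5_edges {1}" "independent_set C5_nodes C5_edges {2}"
    by (auto simp: independent_set_def C5_nodes_def C5_edges_def doubleton_eq_iff)
  moreover have "nbhd C5_nodes C5_edges {1} = {2, 3}" "nbhd C5_nodes C5_edges {2} = {1, 4}"
    by (auto simp: nbhd_def C5_nodes_def C5_edges_def doubleton_eq_iff)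
  ultimately show 12: "l 1 < l 2 + l 3" "l 2 < l 1 + l 4"
    using sum_less[of "{1}"] sum_less[of "{2}"] by simp_all
  have "0 < l 1" "0 < l 2"
    using assms by (auto simp: Ncond_def C5_nodes_def)
  with 12 show "0 < 1 + l 1 / (l 2 + l 3 - l 1) + l 2 / (l 1 + l 4 - l 2)"
    by (intro add_pos_pos divide_pos_pos) auto
qed

end

(* The rates (2, 2, 2, 2, 3) lie in Ncond, and there a = 8 and alpha_tilde = 1/3, so that
   lambda_5 = 3 exceeds a alpha_tilde = 8/3. *)
theory Submission
  imports Defs
begin

text \<open>The product of \<open>a_fun\<close> and \<open>alpha_tilde\<close> does not depend on
  the rate of node 5. With the other four rates equal to 2 it is 8/3, whereas \<open>Ncond\<close>
  allows node 5 any rate below 4: the sets {5}, {1, 5} and {2, 5} bound it by 4. The rate 3 lies in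
  the gap. Membership in \<open>Ncond\<close> is the real work
  (\<open>witness_rates_Ncond\<close>).\<close>

text \<open>Padding with zeros turns a sum over an unknown set into five terms guarded by
  memberships. With \<open>nbhd_C5_iff\<close>, both sides of the \<open>Ncond\<close> inequality
  then depend only on which nodes lie in \<open>I\<close>, and no list of independent sets is
  needed.\<close>

lemma sum_C5_subset:
  assumes "I \<subseteq> C5_nodes"
  shows "(\<Sum>i\<in>I. f i) = (\<Sum>i\<in>C5_nodes. if i \<in> I then f i else (0::real))"
proof -
  have "finite C5_nodes" by (simp add: C5_nodes_def)
  then show ?thesis
    using assms sum.inter_restrict[of C5_nodes f I] by (simp add: Int_absorb1)
qed

lemma nbhd_C5_iff:
  "1 \<in> nbhd C5_nodes C5_edges I \<longleftrightarrow> 2 \<in> I \<or> 3 \<in> I"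
  "2 \<in> nbhd C5_nodes C5_edges I \<longleftrightarrow> 1 \<in> I \<or> 4 \<in> I"
  "3 \<in> nbhd C5_nodes C5_edges I \<longleftrightarrow> 1 \<in> I \<or> 5 \<in> I"
  "4 \<in> nbhd C5_nodes C5_edges I \<longleftrightarrow> 2 \<in> I \<or> 5 \<in> I"
  "5 \<in> nbhd C5_nodes C5_edges I \<longleftrightarrow> 3 \<in> I \<or> 4 \<in> I"
  by (auto simp: nbhd_def C5_nodes_def C5_edges_def doubleton_eq_iff)

lemma independent_set_C5D:
  assumes "independent_set C5_nodes C5_edges I"
  shows "\<not> (1 \<in> I \<and> 2 \<in> I)" "\<not> (1 \<in> I \<and> 3 \<in> I)" "\<not> (2 \<in> I \<and> 4 \<in> I)"
    "\<not> (3 \<in> I \<and> 5 \<in> I)" "\<not> (4 \<in> I \<and> 5 \<in> I)"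
  using assms unfolding independent_set_def C5_edges_def by blast+

text \<open>The restricted abstraction makes the vector extensional, as \<open>Ncond\<close>
  demands.\<close>

definition witness_rates :: "nat \<Rightarrow> real" where
  "witness_rates = (\<lambda>i\<in>C5_nodes. if i = 5 then 3 else 2)"

lemma witness_rates_simps:
  "witness_rates 1 = 2" "witness_rates 2 = 2" "witness_rates 3 = 2"
  "witness_rates 4 = 2" "witness_rates 5 = 3"
  by (simp_all add: witness_rates_def C5_nodes_def)

lemma sum_C5_nodes: "(\<Sum>i\<in>C5_nodes. f i) = f 1 + f 2 + f 3 + f 4 + (f 5 :: real)"
  by (simp add: C5_nodes_def)

lemma witness_rates_Ncond: "witness_rates \<in> Ncond C5_nodes C5_edges"
proof -
  have "(\<Sum>i\<in>I. witness_rates i) < (\<Sum>j\<in>nbhd C5_nodes C5_edges I. witness_rates j)"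
    if "I \<noteq> {}" and ind: "independent_set C5_nodes C5_edges I" for I
  proof -
    have sub: "I \<subseteq> C5_nodes" "nbhd C5_nodes C5_edges I \<subseteq> C5_nodes"
      using ind by (auto simp: independent_set_def nbhd_def)
    then have "1 \<in> I \<or> 2 \<in> I \<or> 3 \<in> I \<or> 4 \<in> I \<or> 5 \<in> I"
      using \<open>I \<noteq> {}\<close> by (auto simp: C5_nodes_def)
    \<comment> \<open>Split on a node of \<open>I\<close>. Independence excludes its two neighbours;
      the other two nodes are adjacent, so at most one of them joins it. This leaves numerical
      inequalities.\<close>
    then show ?thesis
      using independent_set_C5D[OF ind]
      unfolding sum_C5_subset[OF sub(1)] sum_C5_subset[OF sub(2)] sum_C5_nodes
        nbhd_C5_iff witness_rates_simps
      by (elim disjE) simp_all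
  qed
  moreover have "witness_rates \<in> C5_nodes \<rightarrow>\<^sub>E {0<..}"
    by (auto simp: witness_rates_def)
  ultimately show ?thesis by (simp add: Ncond_def)
qed

theorem proposition6:
  "{l. l 5 < a_fun l * alpha_tilde l} \<inter> Ncond C5_nodes C5_edges \<subset> Ncond C5_nodes C5_edges"
proof -
  have "a_fun witness_rates * alpha_tilde witness_rates = 8 / 3"
    by (simp only: a_fun_def alpha_tilde_def witness_rates_simps) simp
  then have "\<not> witness_rates 5 < a_fun witness_rates * alpha_tilde witness_rates"
    by (simp only: witness_rates_simps)
  then show ?thesis using witness_rates_Ncond by blast
qed

end
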